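(* Let $\varphi\in\mathcal{A}=\mathbf{F}[x,y,z]$ be a weight homogeneous polynomial with an isolated singularity, and let $\{\cdot,\cdot\}_\varphi$ be the Poisson bracket on $\mathcal{A}$ determined by $\{x,y\}_\varphi=\frac{\partial\varphi}{\partial z}$, $\{y,z\}_\varphi=\frac{\partial\varphi}{\partial x}$, $\{z,x\}_\varphi=\frac{\partial\varphi}{\partial y}$. Then, for all $m\in\mathbf{N}^*$, every $m$-th order deformation of $\{\cdot,\cdot\}_\varphi$ extends to an $(m+1)$-th order deformation of $\{\cdot,\cdot\}_\varphi$; i.e. for every $m$-th order deformation $\pi_{(m)}=\{\cdot,\cdot\}_\varphi+\pi_1\nu+\cdots+\pi_m\nu^m$ there is a skew-symmetric biderivation $\pi_{m+1}$ of $\mathcal{A}$ such that $\pi_{(m)}+\pi_{m+1}\nu^{m+1}$ is an $(m+1)$-th order deformation.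
   Context: $\mathbf{F}$ is a field of characteristic zero and $\mathbf{N}^*=\{1,2,\dots\}$. A polynomial $\varphi\in\mathbf{F}[x,y,z]$ is weight homogeneous of weighted degree $\varpi(\varphi)\in\mathbf{N}$ if there are positive integers $\varpi_1,\varpi_2,\varpi_3$ without common divisor (the weights of $x,y,z$) with $\varpi_1x\frac{\partial\varphi}{\partial x}+\varpi_2y\frac{\partial\varphi}{\partial y}+\varpi_3z\frac{\partial\varphi}{\partial z}=\varpi(\varphi)\varphi$. It has an isolated singularity (at the origin) if $\mathcal{A}_{sing}(\varphi)=\mathbf{F}[x,y,z]/\langle\frac{\partial\varphi}{\partial x},\frac{\partial\varphi}{\partial y},\frac{\partial\varphi}{\partial z}\rangle$ is finite-dimensional over $\mathbf{F}$, of dimension $\mu\ge1$. An $m$-th order deformation of a Poisson structure $\pi_0$ on a commutative algebra $\mathcal{A}$ is a map $\pi_{(m)}=\pi_0+\pi_1\nu+\cdots+\pi_m\nu^m$ on $\mathcal{A}[[\nu]]/\langle\nu^{m+1}\rangle$, where each $\pi_i:\mathcal{A}\times\mathcal{A}\to\mathcal{A}$ is a skew-symmetric biderivation of $\mathcal{A}$ (extended bilinearly over $\mathbf{F}[[\nu]]/\langle\nu^{m+1}\rangle$), which satisfies the Jacobi identity, i.e. makes $\mathcal{A}[[\nu]]/\langle\nu^{m+1}\rangle$ a Poisson algebra over $\mathbf{F}[[\nu]]/\langle\nu^{m+1}\rangle$. *)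

theory Defs
  imports "HOL-Computational_Algebra.Computational_Algebra"
begin

text \<open>\<open>F[x,y,z]\<close> is realised as the iterated polynomial ring \<open>F[x][y][z]\<close>: \<open>x\<close> is the
  innermost variable and \<open>z\<close> the outermost one.\<close>

type_synonym 'a poly3 = "'a poly poly poly"

definition scalar :: "'a::field_char_0 \<Rightarrow> 'a poly3" where
  "scalar c = [:[:[:c:]:]:]"

definition var_x :: "'a::field_char_0 poly3" where
  "var_x = [:[:[:0, 1:]:]:]"

definition var_y :: "'a::field_char_0 poly3" where
  "var_y = [:[:0, 1:]:]"

definition var_z :: "'a::field_char_0 poly3" where
  "var_z = [:0, 1:]"

definition diff_x :: "'a::field_char_0 poly3 \<Rightarrow> 'a poly3" where
  "diff_x = map_poly (map_poly pderiv)"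

definition diff_y :: "'a::field_char_0 poly3 \<Rightarrow> 'a poly3" where
  "diff_y = map_poly pderiv"

definition diff_z :: "'a::field_char_0 poly3 \<Rightarrow> 'a poly3" where
  "diff_z = pderiv"

definition weight_homogeneous :: "'a::field_char_0 poly3 \<Rightarrow> bool" where
  "weight_homogeneous \<phi> \<longleftrightarrow>
     (\<exists>(w\<^sub>1::nat) (w\<^sub>2::nat) (w\<^sub>3::nat) (d::nat).
        w\<^sub>1 > 0 \<and> w\<^sub>2 > 0 \<and> w\<^sub>3 > 0 \<and> gcd w\<^sub>1 (gcd w\<^sub>2 w\<^sub>3) = 1 \<and>
        of_nat w\<^sub>1 * var_x * diff_x \<phi> + of_nat w\<^sub>2 * var_y * diff_y \<phi>
          + of_nat w\<^sub>3 * var_z * diff_z \<phi> = of_nat d * \<phi>)"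

text \<open>The ideal generated by the partial derivatives: ideals are the submodules of the ring
  acting on itself by multiplication.\<close>

definition jacobian_ideal :: "'a::field_char_0 poly3 \<Rightarrow> 'a poly3 set" where
  "jacobian_ideal \<phi> = module.span (*) {diff_x \<phi>, diff_y \<phi>, diff_z \<phi>}"

text \<open>The classes of the elements of \<open>B\<close> are pairwise distinct and form an \<open>F\<close>-basis of the
  quotient of \<open>F[x,y,z]\<close> by \<open>J\<close>: every class has unique coordinates \<open>c\<close>.\<close>

definition quotient_basis :: "'a::field_char_0 poly3 set \<Rightarrow> 'a poly3 set \<Rightarrow> bool" where
  "quotient_basis J B \<longleftrightarrow> finite B \<and>
     (\<forall>f. \<exists>!c. (\<forall>b. b \<notin> B \<longrightarrow> c b = 0) \<and> f - (\<Sum>b\<in>B. scalar (c b) * b) \<in> J)"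

definition isolated_singularity :: "'a::field_char_0 poly3 \<Rightarrow> bool" where
  "isolated_singularity \<phi> \<longleftrightarrow>
     (\<exists>B \<mu>. quotient_basis (jacobian_ideal \<phi>) B \<and> card B = \<mu> \<and> \<mu> \<ge> 1)"

definition derivation :: "('a::field_char_0 poly3 \<Rightarrow> 'a poly3) \<Rightarrow> bool" where
  "derivation D \<longleftrightarrow>
     (\<forall>f g. D (f + g) = D f + D g) \<and>
     (\<forall>c f. D (scalar c * f) = scalar c * D f) \<and>
     (\<forall>f g. D (f * g) = D f * g + f * D g)"

definition skew_biderivation ::
    "('a::field_char_0 poly3 \<Rightarrow> 'a poly3 \<Rightarrow> 'a poly3) \<Rightarrow> bool" where
  "skew_biderivation P \<longleftrightarrow>
     (\<forall>f g. P f g = - P g f) \<and>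
     (\<forall>g. derivation (\<lambda>f. P f g)) \<and>
     (\<forall>f. derivation (\<lambda>g. P f g))"

definition poisson_bracket ::
    "('a::field_char_0 poly3 \<Rightarrow> 'a poly3 \<Rightarrow> 'a poly3) \<Rightarrow> bool" where
  "poisson_bracket P \<longleftrightarrow> skew_biderivation P \<and>
     (\<forall>f g h. P (P f g) h + P (P g h) f + P (P h f) g = 0)"

text \<open>The bracket determined by \<open>{x,y} = \<partial>\<phi>/\<partial>z\<close>, \<open>{y,z} = \<partial>\<phi>/\<partial>x\<close>, \<open>{z,x} = \<partial>\<phi>/\<partial>y\<close>; see
  \<open>jacobian_bracket_generators\<close>, \<open>jacobian_bracket_poisson\<close> and \<open>jacobian_bracket_unique\<close>.\<close>

definition jacobian_bracket ::
    "'a::field_char_0 poly3 \<Rightarrow> 'a poly3 \<Rightarrow> 'a poly3 \<Rightarrow> 'a poly3" where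
  "jacobian_bracket \<phi> f g =
     diff_z \<phi> * (diff_x f * diff_y g - diff_y f * diff_x g) +
     diff_x \<phi> * (diff_y f * diff_z g - diff_z f * diff_y g) +
     diff_y \<phi> * (diff_z f * diff_x g - diff_x f * diff_z g)"

lemma derivation_map_poly:
  fixes d :: "'b::comm_ring_1 \<Rightarrow> 'b"
  assumes add: "\<And>a b. d (a + b) = d a + d b" and mult: "\<And>a b. d (a * b) = d a * b + a * d b"
  shows "map_poly d (p + q) = map_poly d p + map_poly d q"
    and "map_poly d (p * q) = map_poly d p * q + p * map_poly d q"
proof -
  have d0: "d 0 = 0"
    using add[of 0 0] by simp
  have dsum: "d (\<Sum>i\<in>A. h i) = (\<Sum>i\<in>A. d (h i))" for A :: "nat set" and h
    by (induction A rule: infinite_finite_induct) (simp_all add: d0 add)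
  show "map_poly d (p + q) = map_poly d p + map_poly d q"
    by (rule poly_eqI) (simp add: coeff_map_poly d0 add)
  show "map_poly d (p * q) = map_poly d p * q + p * map_poly d q"
    by (rule poly_eqI) (simp add: coeff_map_poly d0 coeff_mult dsum mult sum.distrib)
qed

lemma diff_add:
  "diff_x (f + g) = diff_x f + diff_x g"
  "diff_y (f + g) = diff_y f + diff_y g"
  "diff_z (f + g) = diff_z f + diff_z g"
  unfolding diff_x_def diff_y_def diff_z_def
  by (intro derivation_map_poly pderiv_add; simp add: pderiv_add pderiv_mult derivation_map_poly)+

lemma diff_mult:
  "diff_x (f * g) = diff_x f * g + f * diff_x g"
  "diff_y (f * g) = diff_y f * g + f * diff_y g"
  "diff_z (f * g) = diff_z f * g + f * diff_z g"
  unfolding diff_x_def diff_y_def diff_z_def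
  by (intro derivation_map_poly; simp add: pderiv_add pderiv_mult derivation_map_poly)+
    (simp add: pderiv_mult algebra_simps)

lemma diff_scalar [simp]:
  "diff_x (scalar c) = 0" "diff_y (scalar c) = 0" "diff_z (scalar c) = 0"
  by (simp_all add: diff_x_def diff_y_def diff_z_def scalar_def map_poly_pCons pderiv_pCons)

lemma diff_var [simp]:
  "diff_x var_x = 1" "diff_y var_x = 0" "diff_z var_x = 0"
  "diff_x var_y = 0" "diff_y var_y = 1" "diff_z var_y = 0"
  "diff_x var_z = 0" "diff_y var_z = 0" "diff_z var_z = 1"
  by (simp_all add: diff_x_def diff_y_def diff_z_def var_x_def var_y_def var_z_def
        map_poly_pCons pderiv_pCons one_pCons)

lemma pderiv_map_poly:
  fixes d :: "'b::idom \<Rightarrow> 'b"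
  assumes add: "\<And>a b. d (a + b) = d a + d b"
  shows "pderiv (map_poly d p) = map_poly d (pderiv p)"
proof -
  have d0: "d 0 = 0"
    using add[of 0 0] by (metis add_0 add_right_imp_eq)
  have "d (of_nat n * a) = of_nat n * d a" for n a
    by (induction n) (simp_all add: d0 add algebra_simps)
  then show ?thesis
    by (intro poly_eqI) (simp add: coeff_map_poly coeff_pderiv d0 del: of_nat_Suc)
qed

lemma diff_commute:
  "diff_y (diff_x f) = diff_x (diff_y f)"
  "diff_z (diff_x f) = diff_x (diff_z f)"
  "diff_z (diff_y f) = diff_y (diff_z f)"
proof -
  have 1: "pderiv (map_poly pderiv p) = map_poly pderiv (pderiv p)" for p :: "'a poly poly"
    by (intro pderiv_map_poly pderiv_add)
  show "diff_y (diff_x f) = diff_x (diff_y f)"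
    by (simp add: diff_x_def diff_y_def map_poly_map_poly o_def 1)
  show "diff_z (diff_x f) = diff_x (diff_z f)"
    unfolding diff_x_def diff_z_def
    by (intro pderiv_map_poly derivation_map_poly) (simp_all add: pderiv_add pderiv_mult)
  show "diff_z (diff_y f) = diff_y (diff_z f)"
    unfolding diff_y_def diff_z_def by (intro pderiv_map_poly pderiv_add)
qed

lemma jacobian_bracket_generators:
  "jacobian_bracket \<phi> var_x var_y = diff_z \<phi>"
  "jacobian_bracket \<phi> var_y var_z = diff_x \<phi>"
  "jacobian_bracket \<phi> var_z var_x = diff_y \<phi>"
  by (simp_all add: jacobian_bracket_def)

lemma diff_diff:
  "diff_x (f - g) = diff_x f - diff_x g"
  "diff_y (f - g) = diff_y f - diff_y g"
  "diff_z (f - g) = diff_z f - diff_z g"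
  using diff_add[of "f - g" g] by (simp_all add: algebra_simps)

lemma jacobian_bracket_poisson: "poisson_bracket (jacobian_bracket \<phi>)"
proof -
  have "skew_biderivation (jacobian_bracket \<phi>)"
    unfolding skew_biderivation_def derivation_def jacobian_bracket_def
    by (simp add: diff_add diff_mult algebra_simps)
  moreover have "jacobian_bracket \<phi> (jacobian_bracket \<phi> f g) h
      + jacobian_bracket \<phi> (jacobian_bracket \<phi> g h) f
      + jacobian_bracket \<phi> (jacobian_bracket \<phi> h f) g = 0" for f g h
    unfolding jacobian_bracket_def diff_add diff_diff diff_mult diff_commute
    by algebra
  ultimately show ?thesis
    by (simp add: poisson_bracket_def)
qed

lemma poly3_induct [case_names scalar x y z add mult]:
  fixes f :: "'a::field_char_0 poly3"
  assumes "\<And>c. Q (scalar c)" "Q var_x" "Q var_y" "Q var_z"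
    and "\<And>f g. Q f \<Longrightarrow> Q g \<Longrightarrow> Q (f + g)" "\<And>f g. Q f \<Longrightarrow> Q g \<Longrightarrow> Q (f * g)"
  shows "Q f"
proof -
  have 1: "Q [:[:p:]:]" for p :: "'a poly"
  proof (induction p)
    case 0
    then show ?case using assms(1)[of 0] by (simp add: scalar_def)
  next
    case (pCons a p)
    have "[:[:pCons a p:]:] = scalar a + var_x * [:[:p:]:]"
      by (simp add: scalar_def var_x_def)
    with pCons assms show ?case by metis
  qed
  have 2: "Q [:p:]" for p :: "'a poly poly"
  proof (induction p)
    case 0
    then show ?case using 1[of 0] by simp
  next
    case (pCons a p)
    have "[:pCons a p:] = [:[:a:]:] + var_y * [:p:]"
      by (simp add: var_y_def)
    with pCons assms 1 show ?case by metis
  qed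
  show ?thesis
  proof (induction f)
    case 0
    then show ?case using 2[of 0] by simp
  next
    case (pCons a p)
    have "pCons a p = [:a:] + var_z * p"
      by (simp add: var_z_def)
    with pCons assms 2 show ?case by metis
  qed
qed

lemma derivation_eqI:
  assumes "derivation D" "derivation E"
    and "D var_x = E var_x" "D var_y = E var_y" "D var_z = E var_z"
  shows "D f = E f"
proof -
  have const: "D' (scalar c) = 0" if D': "derivation D'" for D' and c :: 'a
  proof -
    have "D' 1 = D' 1 + D' 1"
      using D' unfolding derivation_def by (metis mult.right_neutral mult_1)
    then have "D' 1 = 0" by simp
    moreover have "D' (scalar c * 1) = scalar c * D' 1"
      using D' unfolding derivation_def by blast
    ultimately show ?thesis by simp
  qed
  show ?thesis
    using assms by (induction f rule: poly3_induct) (auto simp: const, auto simp: derivation_def)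
qed

lemma jacobian_bracket_unique:
  assumes P: "skew_biderivation P"
    and "P var_x var_y = diff_z \<phi>" "P var_y var_z = diff_x \<phi>" "P var_z var_x = diff_y \<phi>"
  shows "P = jacobian_bracket \<phi>"
proof (intro ext)
  fix f g
  let ?B = "jacobian_bracket \<phi>"
  have B: "skew_biderivation ?B"
    using jacobian_bracket_poisson[of \<phi>] by (simp add: poisson_bracket_def)
  have skew: "P' f g = - P' g f" and der: "derivation (\<lambda>f. P' f g)" "derivation (P' f)"
    if "skew_biderivation P'" for P' and f g :: "'a poly3"
    using that unfolding skew_biderivation_def by blast+
  have zero: "P' f f = 0" if "skew_biderivation P'" for P' and f :: "'a poly3"
    using skew[OF that, of f f] by (simp add: equal_neg_zero)
  have P_gen: "P var_y var_x = - diff_z \<phi>" "P var_z var_y = - diff_x \<phi>" "P var_x var_z = - diff_y \<phi>"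
    by (metis assms(2-4) skew[OF P])+
  have B_gen: "?B var_y var_x = - diff_z \<phi>" "?B var_z var_y = - diff_x \<phi>" "?B var_x var_z = - diff_y \<phi>"
    by (simp_all add: jacobian_bracket_def)
  have gen: "P u v = ?B u v" if "u \<in> {var_x, var_y, var_z}" "v \<in> {var_x, var_y, var_z}" for u v
    using that
    by (elim insertE emptyE; hypsubst)
      (simp_all only: assms(2-4) P_gen B_gen jacobian_bracket_generators zero[OF P] zero[OF B])
  have *: "P u g = ?B u g" if "u \<in> {var_x, var_y, var_z}" for u
    by (rule derivation_eqI[OF der(2)[OF P] der(2)[OF B]]) (use that gen in auto)
  show "P f g = ?B f g"
    by (rule derivation_eqI[OF der(1)[OF P] der(1)[OF B]]) (simp_all add: *)
qed

text \<open>The \<open>F[[\<nu>]]\<close>-bilinear extension of a bilinear map to formal power series in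
  \<open>\<nu> = fps_X\<close>.\<close>

definition fps_bilinear_ext ::
    "('a::field_char_0 poly3 \<Rightarrow> 'a poly3 \<Rightarrow> 'a poly3) \<Rightarrow>
      'a poly3 fps \<Rightarrow> 'a poly3 fps \<Rightarrow> 'a poly3 fps" where
  "fps_bilinear_ext P f g = Abs_fps (\<lambda>n. \<Sum>j\<le>n. P (fps_nth f j) (fps_nth g (n - j)))"

definition truncated_bracket ::
    "nat \<Rightarrow> (nat \<Rightarrow> 'a::field_char_0 poly3 \<Rightarrow> 'a poly3 \<Rightarrow> 'a poly3) \<Rightarrow>
      'a poly3 fps \<Rightarrow> 'a poly3 fps \<Rightarrow> 'a poly3 fps" where
  "truncated_bracket m \<pi> f g = (\<Sum>i\<le>m. fps_X ^ i * fps_bilinear_ext (\<pi> i) f g)"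

text \<open>Elements of \<open>A[[\<nu>]]/\<langle>\<nu>^(m+1)\<rangle>\<close> are represented by power series over \<open>A = F[x,y,z]\<close>, equality in
  the quotient being divisibility of the difference by \<open>\<nu>^(m+1)\<close>. Skew-symmetry, bilinearity
  and the Leibniz rule on the quotient are inherited from the coefficients \<open>\<pi> i\<close>. Only
  \<open>\<pi> 0, ..., \<pi> m\<close> matter.\<close>

definition deformation ::
    "nat \<Rightarrow> ('a::field_char_0 poly3 \<Rightarrow> 'a poly3 \<Rightarrow> 'a poly3) \<Rightarrow>
      (nat \<Rightarrow> 'a poly3 \<Rightarrow> 'a poly3 \<Rightarrow> 'a poly3) \<Rightarrow> bool" where
  "deformation m P \<pi> \<longleftrightarrow>
     poisson_bracket P \<and> \<pi> 0 = P \<and> (\<forall>i\<le>m. skew_biderivation (\<pi> i)) \<and>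
     (\<forall>f g h. fps_X ^ (m + 1) dvd
        truncated_bracket m \<pi> (truncated_bracket m \<pi> f g) h +
        truncated_bracket m \<pi> (truncated_bracket m \<pi> g h) f +
        truncated_bracket m \<pi> (truncated_bracket m \<pi> h f) g)"

end

theory Submission
  imports Defs
begin

text \<open>A skew-symmetric biderivation is given by the 1-form \<open>\<omega> = {y,z} dx + {z,x} dy + {x,y} dz\<close>, and its
  Jacobiator is a multiple of \<open>\<omega> \<and> d\<omega>\<close>. A deformation is thus a form \<open>\<omega> = d\<phi> + \<nu> \<omega>\<^sub>1 + \<dots>\<close> with
  \<open>\<omega> \<and> d\<omega> = 0\<close> modulo a power of \<open>\<nu>\<close>. Such a form has an integrating factor, \<open>\<omega> = u dG\<close> modulo the same
  power of \<open>\<nu>\<close>, as in the theorems of Frobenius and Malgrange; since \<open>u dG \<and> d(u dG) = 0\<close> to all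
  orders, the next coefficient of \<open>u dG\<close> extends the deformation. The factor \<open>u\<close> and the potential \<open>G\<close>
  are built order by order, and each step has to solve \<open>\<eta> = f d\<phi> + dg\<close> for a form with
  \<open>d\<phi> \<and> d\<eta> = 0\<close>. This is possible because the partial derivatives of \<open>\<phi>\<close> generate an ideal that
  contains powers of \<open>x\<close>, \<open>y\<close> and \<open>z\<close>, so that their Koszul complex is exact, and because the division by
  \<open>d\<phi>\<close> lowers the weighted degree.\<close>

section \<open>Koszul exactness\<close>

text \<open>The regular sequence \<open>g1, g2, g3\<close> in the ideal of the \<open>f\<close>'s annihilates the Koszul homology:
  the first step solves the equation up to the factor \<open>g1\<close>, and the other two remove this factor
  again.\<close>

lemma koszul_exact:
  fixes f1 f2 f3 h1 h2 h3 g1 g2 g3 :: "'r::idom"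
  assumes g1: "g1 = u1 * f1 + u2 * f2 + u3 * f3"
    and g2: "g2 = v1 * f1 + v2 * f2 + v3 * f3"
    and g3: "g3 = w1 * f1 + w2 * f2 + w3 * f3"
    and nz: "g1 \<noteq> 0"
    and regular2: "\<And>a b. g2 * a = g1 * b \<Longrightarrow> \<exists>c. a = g1 * c"
    and regular3: "\<And>a b c. g3 * a = g1 * b + g2 * c \<Longrightarrow> \<exists>b' c'. a = g1 * b' + g2 * c'"
    and h: "f1 * h1 + f2 * h2 + f3 * h3 = 0"
  shows "\<exists>k1 k2 k3. h1 = f2 * k3 - f3 * k2 \<and> h2 = f3 * k1 - f1 * k3 \<and> h3 = f1 * k2 - f2 * k1"
proof -
  \<comment> \<open>This is the cross product h \<times> u. As h is orthogonal to f, the double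
    cross product identity gives f \<times> k = \<open>g1\<close> h.\<close>
  define k1 k2 k3 where "k1 = h2 * u3 - h3 * u2" and "k2 = h3 * u1 - h1 * u3"
    and "k3 = h1 * u2 - h2 * u1"
  note k_defs = k1_def k2_def k3_def
  have k: "g1 * h1 = f2 * k3 - f3 * k2" "g1 * h2 = f3 * k1 - f1 * k3"
    "g1 * h3 = f1 * k2 - f2 * k1"
    using h unfolding k_defs g1 by algebra+
  \<comment> \<open>Expanding v \<times> (f \<times> k) gives f s = \<open>g2\<close> k +
    \<open>g1\<close> (v \<times> h). Pairing this with w puts \<open>g3 * s\<close> into the ideal
    of \<open>g1\<close> and \<open>g2\<close>, hence also \<open>s\<close>.\<close>
  define s where "s = v1 * k1 + v2 * k2 + v3 * k3"
  have fs: "f1 * s = g2 * k1 + g1 * (v2 * h3 - v3 * h2)"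
    "f2 * s = g2 * k2 + g1 * (v3 * h1 - v1 * h3)"
    "f3 * s = g2 * k3 + g1 * (v1 * h2 - v2 * h1)"
    using k unfolding s_def g2 by algebra+
  have "g3 * s = g1 * (w1 * (v2 * h3 - v3 * h2) + w2 * (v3 * h1 - v1 * h3) + w3 * (v1 * h2 - v2 * h1))
      + g2 * (w1 * k1 + w2 * k2 + w3 * k3)"
    using fs unfolding g3 by algebra
  then obtain b c where s: "s = g1 * b + g2 * c"
    using regular3 by blast
  \<comment> \<open>Now k - c f is divisible by \<open>g1\<close>. Subtracting a multiple of f does
    not change f \<times> k, so \<open>g1\<close> cancels.\<close>
  have "g2 * (k1 - f1 * c) = g1 * (f1 * b - (v2 * h3 - v3 * h2))"
    "g2 * (k2 - f2 * c) = g1 * (f2 * b - (v3 * h1 - v1 * h3))"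
    "g2 * (k3 - f3 * c) = g1 * (f3 * b - (v1 * h2 - v2 * h1))"
    using fs unfolding s by algebra+
  then obtain l1 l2 l3 where l: "k1 - f1 * c = g1 * l1" "k2 - f2 * c = g1 * l2" "k3 - f3 * c = g1 * l3"
    using regular2 by metis
  have "g1 * h1 = g1 * (f2 * l3 - f3 * l2)" "g1 * h2 = g1 * (f3 * l1 - f1 * l3)"
    "g1 * h3 = g1 * (f1 * l2 - f2 * l1)"
    using k l by algebra+
  then show ?thesis
    using nz by (metis mult_left_cancel)
qed

section \<open>Weighted grading\<close>

lemma eval_map_poly_add:
  assumes "h 0 = 0" "\<And>a b. h (a + b) = h a + h b"
  shows "poly (map_poly h (p + q)) a = poly (map_poly h p) a + poly (map_poly h q) a"
proof -
  have "map_poly h (p + q) = map_poly h p + map_poly h q"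
    by (rule poly_eqI) (simp add: coeff_map_poly assms)
  then show ?thesis by simp
qed

lemma eval_map_poly_mult:
  fixes h :: "'b::comm_ring_1 \<Rightarrow> 'c::comm_ring_1"
  assumes h0: "h 0 = 0" and add: "\<And>a b. h (a + b) = h a + h b"
    and mult: "\<And>a b. h (a * b) = h a * h b"
  shows "poly (map_poly h (p * q)) a = poly (map_poly h p) a * poly (map_poly h q) a"
proof -
  have "h (\<Sum>i\<in>A. g i) = (\<Sum>i\<in>A. h (g i))" for A :: "nat set" and g
    by (induction A rule: infinite_finite_induct) (simp_all add: h0 add)
  then have "map_poly h (p * q) = map_poly h p * map_poly h q"
    by (intro poly_eqI) (simp add: coeff_map_poly h0 coeff_mult mult)
  then show ?thesis by simp
qed

text \<open>The grading is encoded by the homomorphism into \<open>F[x,y,z][t]\<close> that multiplies \<open>x\<close>, \<open>y\<close> and \<open>z\<close> by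
  \<open>t^w1\<close>, \<open>t^w2\<close> and \<open>t^w3\<close>: the coefficient of \<open>t^n\<close> is the homogeneous component of weight \<open>n\<close>.\<close>

definition weight_hom :: "nat \<Rightarrow> nat \<Rightarrow> nat \<Rightarrow> 'a::field_char_0 poly3 \<Rightarrow> 'a poly3 poly" where
  "weight_hom w1 w2 w3 f =
     poly (map_poly (\<lambda>q. poly (map_poly (\<lambda>p. poly (map_poly (\<lambda>c. [:scalar c:]) p)
       (monom var_x w1)) q) (monom var_y w2)) f) (monom var_z w3)"

lemma scalar_simps: "scalar 0 = 0" "scalar 1 = 1" "scalar (a + b) = scalar a + scalar b"
  "scalar (a * b) = scalar a * scalar b"
  by (simp_all add: scalar_def one_pCons)

lemma weight_hom_add: "weight_hom w1 w2 w3 (f + g) = weight_hom w1 w2 w3 f + weight_hom w1 w2 w3 g"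
  unfolding weight_hom_def by (intro eval_map_poly_add) (simp_all add: scalar_simps)

lemma weight_hom_mult: "weight_hom w1 w2 w3 (f * g) = weight_hom w1 w2 w3 f * weight_hom w1 w2 w3 g"
  unfolding weight_hom_def
  by (intro eval_map_poly_mult eval_map_poly_add) (simp_all add: scalar_simps)

lemma weight_hom_generators [simp]:
  "weight_hom w1 w2 w3 (scalar c) = [:scalar c:]"
  "weight_hom w1 w2 w3 var_x = monom var_x w1"
  "weight_hom w1 w2 w3 var_y = monom var_y w2"
  "weight_hom w1 w2 w3 var_z = monom var_z w3"
  by (simp_all add: weight_hom_def scalar_def var_x_def var_y_def var_z_def map_poly_pCons
      smult_monom one_pCons)

lemma scalar_of_nat: "scalar (of_nat n) = of_nat n"
  by (induction n) (simp_all add: scalar_simps)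

lemma weight_hom_simps:
  "weight_hom w1 w2 w3 0 = 0" "weight_hom w1 w2 w3 1 = 1" "weight_hom w1 w2 w3 (of_nat n) = of_nat n"
proof -
  show "weight_hom w1 w2 w3 (of_nat n) = of_nat n"
    using weight_hom_generators(1)[of w1 w2 w3 "of_nat n"] by (simp add: scalar_of_nat of_nat_poly)
  show "weight_hom w1 w2 w3 0 = 0" "weight_hom w1 w2 w3 1 = 1"
    using weight_hom_generators(1)[of w1 w2 w3 0] weight_hom_generators(1)[of w1 w2 w3 1]
    by (simp_all add: scalar_simps one_pCons)
qed

lemma poly_weight_hom: "poly (weight_hom w1 w2 w3 f) 1 = f"
  by (induction f rule: poly3_induct) (simp_all add: weight_hom_add weight_hom_mult poly_monom)

lemma diff_of_nat [simp]:
  "diff_x (of_nat n) = 0" "diff_y (of_nat n) = 0" "diff_z (of_nat n) = 0"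
  by (simp_all flip: scalar_of_nat)

lemma diff_0 [simp]: "diff_x 0 = 0" "diff_y 0 = 0" "diff_z 0 = 0"
  by (simp_all add: diff_x_def diff_y_def diff_z_def)

lemma derivation_const:
  assumes "derivation D"
  shows "D (scalar c) = 0"
proof -
  have "D 1 = D 1 + D 1"
    using assms unfolding derivation_def by (metis mult.right_neutral mult_1)
  moreover have "D (scalar c * 1) = scalar c * D 1"
    using assms unfolding derivation_def by blast
  ultimately show ?thesis by simp
qed

lemma derivation_diff: "derivation diff_x" "derivation diff_y" "derivation diff_z"
  by (simp_all add: derivation_def diff_add diff_mult)

text \<open>Both sides are additive and obey the Leibniz rule along \<open>weight_hom\<close>, so
  the generators decide. The power of t makes up for a derivation that lowers weights by
  \<open>e\<close>.\<close>

lemma weight_hom_derivation: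
  assumes D: "derivation D"
    and gen: "\<And>v. v \<in> {var_x, var_y, var_z} \<Longrightarrow>
      monom 1 e * weight_hom w1 w2 w3 (D v) = map_poly D (weight_hom w1 w2 w3 v)"
  shows "monom 1 e * weight_hom w1 w2 w3 (D f) = map_poly D (weight_hom w1 w2 w3 f)"
proof -
  have D_rules: "D (a + b) = D a + D b" "D (a * b) = D a * b + a * D b" for a b
    using D unfolding derivation_def by blast+
  note map_D = derivation_map_poly[of D, OF D_rules]
  have D0: "D 0 = 0" using D_rules(1)[of 0 0] by simp
  show ?thesis
  proof (induction f rule: poly3_induct)
    case (scalar c)
    then show ?case by (simp add: derivation_const[OF D] weight_hom_simps map_poly_pCons D0)
  next
    case (add f g)
    then show ?case by (simp add: D_rules map_D weight_hom_add distrib_left)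
  next
    case (mult f g)
    then show ?case
      by (simp only: D_rules map_D weight_hom_add weight_hom_mult mult[symmetric] distrib_left ac_simps)
  qed (simp_all add: gen)
qed

lemma weight_hom_diff:
  "monom 1 w1 * weight_hom w1 w2 w3 (diff_x f) = map_poly diff_x (weight_hom w1 w2 w3 f)"
  "monom 1 w2 * weight_hom w1 w2 w3 (diff_y f) = map_poly diff_y (weight_hom w1 w2 w3 f)"
  "monom 1 w3 * weight_hom w1 w2 w3 (diff_z f) = map_poly diff_z (weight_hom w1 w2 w3 f)"
  by (rule weight_hom_derivation[OF derivation_diff(1)],
      auto simp: weight_hom_simps map_poly_monom)
    (rule weight_hom_derivation[OF derivation_diff(2)] weight_hom_derivation[OF derivation_diff(3)],
      auto simp: weight_hom_simps map_poly_monom)+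

definition euler :: "nat \<Rightarrow> nat \<Rightarrow> nat \<Rightarrow> 'a::field_char_0 poly3 \<Rightarrow> 'a poly3" where
  "euler w1 w2 w3 f = of_nat w1 * var_x * diff_x f + of_nat w2 * var_y * diff_y f
     + of_nat w3 * var_z * diff_z f"

lemma derivation_euler: "derivation (euler w1 w2 w3)"
  by (simp add: derivation_def euler_def diff_add diff_mult algebra_simps)

lemma coeff_of_nat_mult: "coeff (of_nat n * p) k = of_nat n * coeff p k"
  by (induction n) (simp_all add: distrib_right)

lemma of_nat_mult_monom: "of_nat n * monom c k = monom (of_nat n * c) k"
  by (rule poly_eqI) (simp add: coeff_of_nat_mult)

lemma X_pderiv_monom: "[:0, 1:] * pderiv (monom c n) = monom (of_nat n * c) n"
  by (rule poly_eqI) (auto simp: coeff_pCons coeff_pderiv split: nat.splits)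

text \<open>Coefficientwise \<open>euler\<close> and the operator t d/dt agree on the images of the
  generators and obey the same Leibniz rule.\<close>

lemma euler_coeff_weight_hom:
  "euler w1 w2 w3 (coeff (weight_hom w1 w2 w3 f) n) = of_nat n * coeff (weight_hom w1 w2 w3 f) n"
proof -
  let ?T = "weight_hom w1 w2 w3" and ?E = "euler w1 w2 w3"
  have D_rules: "?E (a + b) = ?E a + ?E b" "?E (a * b) = ?E a * b + a * ?E b" for a b :: "'a poly3"
    using derivation_euler unfolding derivation_def by blast+
  note map_D = derivation_map_poly[of ?E, OF D_rules]
  have E0: "?E 0 = 0" by (simp add: euler_def)
  have map_monom: "map_poly ?E (monom c n) = monom (?E c) n" for c n
    by (simp add: map_poly_monom E0)
  have "map_poly ?E (?T f) = [:0, 1:] * pderiv (?T f)"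
  proof (induction f rule: poly3_induct)
    case (scalar c)
    then show ?case by (simp add: derivation_const[OF derivation_euler] map_poly_pCons E0 pderiv_pCons)
  next
    case (add f g)
    then show ?case by (simp only: map_D weight_hom_add pderiv_add distrib_left)
  next
    case (mult f g)
    then show ?case
      by (simp only: map_D weight_hom_mult pderiv_mult distrib_left ac_simps)
  qed (simp_all only: weight_hom_generators X_pderiv_monom map_monom, simp_all add: euler_def)
  from arg_cong[OF this, of "\<lambda>p. coeff p n"] show ?thesis
    by (simp add: coeff_map_poly E0 coeff_pCons coeff_pderiv split: nat.splits)
qed

lemma weight_hom_euler:
  "coeff (weight_hom w1 w2 w3 (euler w1 w2 w3 f)) n = of_nat n * coeff (weight_hom w1 w2 w3 f) n"
proof -
  let ?T = "weight_hom w1 w2 w3" and ?E = "euler w1 w2 w3"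
  have D_rules: "?E (a + b) = ?E a + ?E b" "?E (a * b) = ?E a * b + a * ?E b" for a b :: "'a poly3"
    using derivation_euler unfolding derivation_def by blast+
  have "?T (?E f) = [:0, 1:] * pderiv (?T f)"
  proof (induction f rule: poly3_induct)
    case (scalar c)
    then show ?case by (simp add: derivation_const[OF derivation_euler] weight_hom_simps pderiv_pCons)
  next
    case (add f g)
    then show ?case by (simp only: D_rules weight_hom_add pderiv_add distrib_left)
  next
    case (mult f g)
    then show ?case
      by (simp only: D_rules weight_hom_add weight_hom_mult pderiv_mult distrib_left ac_simps)
  qed (simp_all only: weight_hom_generators X_pderiv_monom,
    simp_all add: euler_def weight_hom_mult weight_hom_simps of_nat_mult_monom)
  from arg_cong[OF this, of "\<lambda>p. coeff p n"] show ?thesis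
    by (simp add: coeff_pCons coeff_pderiv split: nat.splits)
qed

section \<open>Weight components of forms and the Poincare lemma\<close>

locale weights =
  fixes w1 w2 w3 :: nat
  assumes weights_pos: "w1 > 0" "w2 > 0" "w3 > 0"
begin

abbreviation "T \<equiv> weight_hom w1 w2 w3"
abbreviation "E \<equiv> euler w1 w2 w3"

text \<open>Differentials carry weight as well: \<open>component e n f\<close> is the coefficient function of the weight
  \<open>n\<close> part of a form \<open>f \<theta>\<close>, where \<open>\<theta>\<close> has weight \<open>e\<close> (\<open>e = w1\<close> for \<open>\<theta> = dx\<close>, and so on).\<close>

definition component :: "nat \<Rightarrow> nat \<Rightarrow> 'a::field_char_0 poly3 \<Rightarrow> 'a poly3" where
  "component e n f = coeff (monom 1 e * T f) n"

lemma component_eq: "component e n f = (if e \<le> n then coeff (T f) (n - e) else 0)"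
  by (simp add: component_def coeff_monom_mult)

lemma component_add: "component e n (f + g) = component e n f + component e n g"
  by (simp add: component_eq weight_hom_add)

lemma component_diff: "component e n (f - g) = component e n f - component e n g"
  using component_add[of e n "f - g" g] by simp

lemma component_weight_0: "e > 0 \<Longrightarrow> component e 0 f = 0"
  by (simp add: component_eq)

lemma component_derivation:
  assumes "D 0 = 0" "monom 1 w * T (D f) = map_poly D (T f)"
  shows "component (e + w) n (D f) = D (component e n f)"
proof -
  have "monom 1 (e + w) * T (D f) = monom 1 e * map_poly D (T f)"
    unfolding assms(2)[symmetric] by (simp add: mult_monom flip: mult.assoc)
  then show ?thesis
    by (simp add: component_def coeff_monom_mult coeff_map_poly assms(1))
qed

text \<open>The exterior derivative preserves weight: what a partial derivative takes away, the
  added differential restores.\<close>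

lemma component_partial:
  "component (e + w1) n (diff_x f) = diff_x (component e n f)"
  "component (e + w2) n (diff_y f) = diff_y (component e n f)"
  "component (e + w3) n (diff_z f) = diff_z (component e n f)"
  by (simp_all add: component_derivation weight_hom_diff)

lemma component_partial_left:
  "component (w1 + e) n (diff_x f) = diff_x (component e n f)"
  "component (w2 + e) n (diff_y f) = diff_y (component e n f)"
  "component (w3 + e) n (diff_z f) = diff_z (component e n f)"
  using component_partial[of e n f] by (simp_all only: add.commute)

text \<open>Meant for a partial derivative \<open>g\<close> of the potential: d\<phi> has weight
  \<open>d\<close>, so multiplication by it raises weights by \<open>d\<close>.\<close>

lemma component_mult:
  fixes g :: "'a::field_char_0 poly3"
  assumes "monom 1 w * T g = monom g d"
  shows "component (e + w) (n + d) (g * f) = g * component e n f"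
    and "n < d \<Longrightarrow> component (e + w) n (g * f) = 0"
proof -
  have monom_add: "monom 1 (e + w) = monom 1 e * (monom 1 w :: 'a poly3 poly)"
    by (simp add: mult_monom)
  have *: "monom 1 (e + w) * T (g * f) = monom g d * (monom 1 e * T f)"
  proof -
    have "monom 1 (e + w) * T (g * f) = (monom 1 w * T g) * (monom 1 e * T f)"
      by (simp only: weight_hom_mult monom_add ac_simps)
    then show ?thesis by (simp only: assms)
  qed
  show "component (e + w) (n + d) (g * f) = g * component e n f"
    "n < d \<Longrightarrow> component (e + w) n (g * f) = 0"
    unfolding component_def * by (simp_all only: coeff_monom_mult) auto
qed

lemma euler_component: "E (component e n f) = (of_nat n - of_nat e) * component e n f"
  by (auto simp: component_eq euler_coeff_weight_hom) (simp add: euler_def)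

lemma sum_component:
  assumes "degree (monom 1 e * T f) \<le> N"
  shows "(\<Sum>n\<le>N. component e n f) = f"
proof -
  have "f = poly (monom 1 e * T f) 1"
    by (simp add: poly_monom poly_weight_hom)
  also have "\<dots> = (\<Sum>n\<le>degree (monom 1 e * T f). component e n f)"
    by (simp add: poly_altdef component_def)
  also have "\<dots> = (\<Sum>n\<le>N. component e n f)"
    using assms by (intro sum.mono_neutral_left) (auto simp: component_def coeff_eq_0)
  finally show ?thesis by simp
qed

text \<open>A form is the finite sum of its weight components, so additive properties can be checked
  on these.\<close>

lemma form_components_induct:
  fixes a b c :: "'a::field_char_0 poly3"
  assumes zero: "V 0 0 0"
    and add: "\<And>a b c a' b' c'. V a b c \<Longrightarrow> V a' b' c' \<Longrightarrow> V (a + a') (b + b') (c + c')"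
    and comp: "\<And>n. V (component w1 n a) (component w2 n b) (component w3 n c)"
  shows "V a b c"
proof -
  define N where "N = Max {degree (monom 1 w1 * T a), degree (monom 1 w2 * T b), degree (monom 1 w3 * T c)}"
  have "V (\<Sum>n\<in>A. component w1 n a) (\<Sum>n\<in>A. component w2 n b) (\<Sum>n\<in>A. component w3 n c)"
    if "finite A" for A
    using that by induction (simp_all add: zero add comp)
  from this[of "{..N}"] show ?thesis
    by (simp add: sum_component N_def)
qed

text \<open>The Poincare lemma, weight by weight: forms have no component of weight 0, and every
  other weight is invertible in characteristic zero.\<close>

lemma closed_imp_exact:
  fixes a b c :: "'a::field_char_0 poly3"
  assumes "diff_y c = diff_z b" "diff_z a = diff_x c" "diff_x b = diff_y a"
  shows "\<exists>h. a = diff_x h \<and> b = diff_y h \<and> c = diff_z h"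
proof (rule form_components_induct[where V = "\<lambda>a b c. \<exists>h. a = diff_x h \<and> b = diff_y h \<and> c = diff_z h"])
  show "\<exists>h. 0 = diff_x h \<and> 0 = diff_y h \<and> 0 = diff_z (h :: 'a poly3)"
    by (intro exI[of _ 0]) simp
next
  fix a b c a' b' c' :: "'a poly3"
  assume "\<exists>h. a = diff_x h \<and> b = diff_y h \<and> c = diff_z h"
    and "\<exists>h. a' = diff_x h \<and> b' = diff_y h \<and> c' = diff_z h"
  then show "\<exists>h. a + a' = diff_x h \<and> b + b' = diff_y h \<and> c + c' = diff_z h"
    by (metis diff_add)
next
  fix n
  let ?a = "component w1 n a" and ?b = "component w2 n b" and ?c = "component w3 n c"
  show "\<exists>h. ?a = diff_x h \<and> ?b = diff_y h \<and> ?c = diff_z h"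
  proof (cases "n = 0")
    case True
    then show ?thesis
      using weights_pos by (intro exI[of _ 0]) (simp add: component_weight_0)
  next
    case False
    have closed: "diff_y ?c = diff_z ?b" "diff_z ?a = diff_x ?c" "diff_x ?b = diff_y ?a"
      using assms by (metis component_partial add.commute)+
    \<comment> \<open>Contraction with the Euler field inverts \<open>d\<close> on closed forms of weight \<open>n\<close>, up to the factor \<open>n\<close>.\<close>
    define h where "h = scalar (1 / of_nat n) *
      (of_nat w1 * var_x * ?a + of_nat w2 * var_y * ?b + of_nat w3 * var_z * ?c)"
    have inv: "scalar (1 / of_nat n) * of_nat n = (1 :: 'a poly3)"
      using False by (simp flip: scalar_of_nat scalar_simps(4)) (simp add: scalar_simps)
    \<comment> \<open>Cartan's formula: on a closed form, d of the contraction is the Lie derivative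
      along the Euler field. For the first coefficient, \<open>w1\<close> comes from dx and
      \<open>n - w1\<close> from \<open>?a\<close>.\<close>
    have "diff_x h = scalar (1 / of_nat n) * (of_nat w1 * ?a + E ?a)"
      "diff_y h = scalar (1 / of_nat n) * (of_nat w2 * ?b + E ?b)"
      "diff_z h = scalar (1 / of_nat n) * (of_nat w3 * ?c + E ?c)"
      by (simp_all add: h_def diff_mult diff_add euler_def closed algebra_simps)
    then have "diff_x h = (scalar (1 / of_nat n) * of_nat n) * ?a"
      "diff_y h = (scalar (1 / of_nat n) * of_nat n) * ?b"
      "diff_z h = (scalar (1 / of_nat n) * of_nat n) * ?c"
      by (simp_all add: euler_component algebra_simps)
    then show ?thesis
      by (intro exI[of _ h]) (simp add: inv)
  qed
qed

end

section \<open>Division by the differential of the potential\<close>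

locale weighted_potential = weights +
  fixes \<phi> :: "'a::field_char_0 poly3" and d :: nat
  assumes d_pos: "d > 0" and euler_potential: "E \<phi> = of_nat d * \<phi>"
    and koszul: "\<And>h1 h2 h3. diff_x \<phi> * h1 + diff_y \<phi> * h2 + diff_z \<phi> * h3 = 0 \<Longrightarrow>
      \<exists>k1 k2 k3. h1 = diff_y \<phi> * k3 - diff_z \<phi> * k2 \<and> h2 = diff_z \<phi> * k1 - diff_x \<phi> * k3
        \<and> h3 = diff_x \<phi> * k2 - diff_y \<phi> * k1"

text \<open>The factor \<open>n - d\<close> annihilates the coefficient of t^n, so only
  \<open>n = d\<close> survives; setting t = 1 identifies that coefficient.\<close>

lemma weight_hom_eigenvector:
  assumes "euler w1 w2 w3 f = of_nat d * f"
  shows "weight_hom w1 w2 w3 f = monom f d"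
proof -
  let ?T = "weight_hom w1 w2 w3"
  have "coeff (?T f) n = 0" if "n \<noteq> d" for n
  proof -
    have "of_nat n * coeff (?T f) n = of_nat d * coeff (?T f) n"
      using weight_hom_euler[of w1 w2 w3 f n]
      by (auto simp: assms weight_hom_mult weight_hom_simps coeff_of_nat_mult)
    with that show ?thesis by auto
  qed
  then have *: "?T f = monom (coeff (?T f) d) d"
    by (intro poly_eqI) auto
  moreover have "f = coeff (?T f) d"
    using poly_weight_hom[of w1 w2 w3 f] by (subst (asm) *) (simp add: poly_monom)
  ultimately show ?thesis by simp
qed

lemma weight_hom_partials:
  assumes "euler w1 w2 w3 \<phi> = of_nat d * \<phi>"
  shows "monom 1 w1 * weight_hom w1 w2 w3 (diff_x \<phi>) = monom (diff_x \<phi>) d"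
    and "monom 1 w2 * weight_hom w1 w2 w3 (diff_y \<phi>) = monom (diff_y \<phi>) d"
    and "monom 1 w3 * weight_hom w1 w2 w3 (diff_z \<phi>) = monom (diff_z \<phi>) d"
  by (simp_all add: weight_hom_diff weight_hom_eigenvector[OF assms] map_poly_monom)

context weighted_potential begin

lemmas component_mult_partial =
  component_mult[OF weight_hom_partials(1)[OF euler_potential]]
  component_mult[OF weight_hom_partials(2)[OF euler_potential]]
  component_mult[OF weight_hom_partials(3)[OF euler_potential]]

text \<open>If \<open>d\<phi> \<and> d\<omega> = 0\<close>, then \<open>d\<omega> = d\<phi> \<and> \<eta>\<close> by Koszul exactness, and \<open>\<eta>\<close> satisfies the same hypothesis
  in a weight that is smaller by \<open>d\<close>. Writing \<open>\<eta> = f d\<phi> + dg\<close>, the form \<open>\<omega> + g d\<phi>\<close> is closed.\<close>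

lemma relative_closed_component:
  assumes "diff_x \<phi> * (diff_y c - diff_z b) + diff_y \<phi> * (diff_z a - diff_x c)
    + diff_z \<phi> * (diff_x b - diff_y a) = 0"
  shows "\<exists>f g. component w1 n a = f * diff_x \<phi> + diff_x g \<and>
    component w2 n b = f * diff_y \<phi> + diff_y g \<and> component w3 n c = f * diff_z \<phi> + diff_z g"
  using assms
proof (induction n arbitrary: a b c rule: less_induct)
  case (less n)
  obtain k1 k2 k3 where k: "diff_y c - diff_z b = diff_y \<phi> * k3 - diff_z \<phi> * k2"
    "diff_z a - diff_x c = diff_z \<phi> * k1 - diff_x \<phi> * k3"
    "diff_x b - diff_y a = diff_x \<phi> * k2 - diff_y \<phi> * k1"
    using koszul[OF less.prems] by blast
  \<comment> \<open>From d(d\<omega>) = 0 and d\<omega> = d\<phi> \<and> \<eta> follows d\<phi>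
    \<and> d\<eta> = 0, where \<eta> has the coefficients \<open>k1\<close>, \<open>k2\<close>,
    \<open>k3\<close>.\<close>
  have "diff_x (diff_y c - diff_z b) + diff_y (diff_z a - diff_x c) + diff_z (diff_x b - diff_y a) = 0"
    by (simp add: diff_diff diff_commute)
  then have k_closed: "diff_x \<phi> * (diff_y k3 - diff_z k2) + diff_y \<phi> * (diff_z k1 - diff_x k3)
    + diff_z \<phi> * (diff_x k2 - diff_y k1) = 0"
    unfolding k by (simp add: diff_diff diff_mult diff_commute algebra_simps)
  let ?a = "component w1 n a" and ?b = "component w2 n b" and ?c = "component w3 n c"
  have curl: "diff_y ?c - diff_z ?b = component (w2 + w3) n (diff_y c - diff_z b)"
    "diff_z ?a - diff_x ?c = component (w3 + w1) n (diff_z a - diff_x c)"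
    "diff_x ?b - diff_y ?a = component (w1 + w2) n (diff_x b - diff_y a)"
    unfolding component_diff
    by (simp_all add: component_partial component_partial_left)
  have "\<exists>g. diff_y ?c - diff_z ?b = diff_y \<phi> * diff_z g - diff_z \<phi> * diff_y g
    \<and> diff_z ?a - diff_x ?c = diff_z \<phi> * diff_x g - diff_x \<phi> * diff_z g
    \<and> diff_x ?b - diff_y ?a = diff_x \<phi> * diff_y g - diff_y \<phi> * diff_x g"
  proof (cases "n < d")
    \<comment> \<open>A product with d\<phi> has no part of weight below \<open>d\<close>, so the
      descent ends here.\<close>
    case True
    have zero: "component (w + w1) n (diff_x \<phi> * f) = 0" "component (w1 + w) n (diff_x \<phi> * f) = 0"
      "component (w + w2) n (diff_y \<phi> * f) = 0" "component (w2 + w) n (diff_y \<phi> * f) = 0"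
      "component (w + w3) n (diff_z \<phi> * f) = 0" "component (w3 + w) n (diff_z \<phi> * f) = 0" for w f
      using component_mult_partial(2,4,6)[OF True, of w f] by (simp_all only: add.commute)
    have "diff_y ?c - diff_z ?b = 0" "diff_z ?a - diff_x ?c = 0" "diff_x ?b - diff_y ?a = 0"
      unfolding curl k component_diff zero by simp_all
    then show ?thesis by (intro exI[of _ 0]) simp
  next
    case False
    then obtain n' where n: "n = n' + d" by (metis add.commute le_add_diff_inverse not_less)
    then have "n' < n" using d_pos by simp
    from less.IH[OF this k_closed] obtain f g where
      fg: "component w1 n' k1 = f * diff_x \<phi> + diff_x g"
      "component w2 n' k2 = f * diff_y \<phi> + diff_y g" "component w3 n' k3 = f * diff_z \<phi> + diff_z g"
      by blast
    have mult: "component (w + w1) n (diff_x \<phi> * f) = diff_x \<phi> * component w n' f"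
      "component (w1 + w) n (diff_x \<phi> * f) = diff_x \<phi> * component w n' f"
      "component (w + w2) n (diff_y \<phi> * f) = diff_y \<phi> * component w n' f"
      "component (w2 + w) n (diff_y \<phi> * f) = diff_y \<phi> * component w n' f"
      "component (w + w3) n (diff_z \<phi> * f) = diff_z \<phi> * component w n' f"
      "component (w3 + w) n (diff_z \<phi> * f) = diff_z \<phi> * component w n' f" for w f
      unfolding n using component_mult_partial(1,3,5)[of w n' f] by (simp_all only: add.commute)
    \<comment> \<open>The summand f d\<phi> of \<eta> drops out of d\<phi> \<and> \<eta>.\<close>
    show ?thesis
      unfolding curl k component_diff mult fg by (intro exI[of _ g]) (simp add: algebra_simps)
  qed
  then obtain g where g: "diff_y ?c - diff_z ?b = diff_y \<phi> * diff_z g - diff_z \<phi> * diff_y g"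
    "diff_z ?a - diff_x ?c = diff_z \<phi> * diff_x g - diff_x \<phi> * diff_z g"
    "diff_x ?b - diff_y ?a = diff_x \<phi> * diff_y g - diff_y \<phi> * diff_x g"
    by blast
  have "\<exists>h. ?a + g * diff_x \<phi> = diff_x h \<and> ?b + g * diff_y \<phi> = diff_y h \<and> ?c + g * diff_z \<phi> = diff_z h"
    using g by (intro closed_imp_exact) (simp_all add: diff_add diff_mult diff_commute algebra_simps)
  then obtain h where h: "?a + g * diff_x \<phi> = diff_x h" "?b + g * diff_y \<phi> = diff_y h"
    "?c + g * diff_z \<phi> = diff_z h"
    by blast
  show ?case
    by (intro exI[of _ "- g"] exI[of _ h]) (simp flip: h)
qed

lemma relative_closed:
  assumes "diff_x \<phi> * (diff_y c - diff_z b) + diff_y \<phi> * (diff_z a - diff_x c)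
    + diff_z \<phi> * (diff_x b - diff_y a) = 0"
  shows "\<exists>f g. a = f * diff_x \<phi> + diff_x g \<and> b = f * diff_y \<phi> + diff_y g \<and> c = f * diff_z \<phi> + diff_z g"
proof (rule form_components_induct[where V = "\<lambda>a b c. \<exists>f g. a = f * diff_x \<phi> + diff_x g \<and>
    b = f * diff_y \<phi> + diff_y g \<and> c = f * diff_z \<phi> + diff_z g"])
  show "\<exists>f g. 0 = f * diff_x \<phi> + diff_x g \<and> 0 = f * diff_y \<phi> + diff_y g \<and> 0 = f * diff_z \<phi> + diff_z g"
    by (intro exI[of _ 0]) simp
next
  fix a b c a' b' c'
  assume "\<exists>f g. a = f * diff_x \<phi> + diff_x g \<and> b = f * diff_y \<phi> + diff_y g \<and> c = f * diff_z \<phi> + diff_z g"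
  then obtain f g where 1: "a = f * diff_x \<phi> + diff_x g" "b = f * diff_y \<phi> + diff_y g"
    "c = f * diff_z \<phi> + diff_z g" by blast
  assume "\<exists>f g. a' = f * diff_x \<phi> + diff_x g \<and> b' = f * diff_y \<phi> + diff_y g \<and> c' = f * diff_z \<phi> + diff_z g"
  then obtain f' g' where 2: "a' = f' * diff_x \<phi> + diff_x g'" "b' = f' * diff_y \<phi> + diff_y g'"
    "c' = f' * diff_z \<phi> + diff_z g'" by blast
  show "\<exists>f g. a + a' = f * diff_x \<phi> + diff_x g \<and> b + b' = f * diff_y \<phi> + diff_y g \<and> c + c' = f * diff_z \<phi> + diff_z g"
    unfolding 1 2 by (intro exI[of _ "f + f'"] exI[of _ "g + g'"]) (simp add: diff_add algebra_simps)
qed (rule relative_closed_component[OF assms])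

end

section \<open>Isolated singularities\<close>

lemma coeff_var_power_mult:
  "coeff (var_x ^ i * f) n = [:[:0, 1:]:] ^ i * coeff f n"
  "coeff (var_y ^ i * f) n = [:0, 1:] ^ i * coeff f n"
  by (induction i arbitrary: f) (simp_all add: var_x_def var_y_def mult.assoc)

lemma coeff_var_power_mult':
  fixes f :: "'a::field_char_0 poly poly"
  shows "coeff ([:[:0, 1:]:] ^ i * f) n = [:0, 1:] ^ i * coeff f n"
  by (induction i arbitrary: f) (simp_all add: mult.assoc)

lemma X_power: "[:0, 1:] ^ i = (monom 1 i :: 'b::comm_ring_1 poly)"
  by (simp add: monom_altdef)

text \<open>Division by a power of z is a shift of the outermost coefficients. The shift is linear
  over F[x,y], so it acts on the cofactors \<open>b\<close> and \<open>c\<close>.\<close>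

lemma var_z_power_regular:
  fixes a b c :: "'a::field_char_0 poly3"
  assumes "var_z ^ k * a = var_x ^ i * b + var_y ^ j * c"
  shows "\<exists>b' c'. a = var_x ^ i * b' + var_y ^ j * c'"
proof -
  have "coeff a n = coeff (var_z ^ k * a) (n + k)" for n
    by (simp add: var_z_def X_power coeff_monom_mult)
  then have "a = var_x ^ i * poly_shift k b + var_y ^ j * poly_shift k c"
    by (intro poly_eqI) (simp add: assms coeff_var_power_mult coeff_poly_shift)
  then show ?thesis by blast
qed

text \<open>The same shift, performed inside each coefficient because y is the middle
  variable.\<close>

lemma var_y_power_regular:
  fixes a b :: "'a::field_char_0 poly3"
  assumes "var_y ^ j * a = var_x ^ i * b"
  shows "\<exists>c. a = var_x ^ i * c"
proof -
  have "coeff (coeff a n) l = coeff (coeff (var_y ^ j * a) n) (l + j)" for n l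
    by (simp add: coeff_var_power_mult X_power coeff_monom_mult)
  then have "a = var_x ^ i * map_poly (poly_shift j) b"
    by (intro poly_eqI) (simp add: assms coeff_var_power_mult coeff_var_power_mult'
        coeff_poly_shift coeff_map_poly)
  then show ?thesis by blast
qed

lemma jacobian_idealE:
  assumes "f \<in> jacobian_ideal \<phi>"
  obtains u1 u2 u3 where "f = u1 * diff_x \<phi> + u2 * diff_y \<phi> + u3 * diff_z \<phi>"
proof -
  interpret module "(*) :: 'a poly3 \<Rightarrow> 'a poly3 \<Rightarrow> 'a poly3"
    by unfold_locales (simp_all add: algebra_simps)
  obtain u1 u2 u3 where "f - u1 * diff_x \<phi> - u2 * diff_y \<phi> - u3 * diff_z \<phi> = 0"
    using assms unfolding jacobian_ideal_def span_insert by auto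
  then show thesis
    using that[of u1 u2 u3] by (simp add: algebra_simps)
qed

lemma weight_hom_power:
  assumes "weight_hom w1 w2 w3 v = monom v w"
  shows "weight_hom w1 w2 w3 (v ^ n) = monom (v ^ n) (w * n)"
  by (induction n) (simp_all add: weight_hom_mult assms mult_monom weight_hom_simps add.commute)

lemma weight_hom_diff_eq: "weight_hom w1 w2 w3 (f - g) = weight_hom w1 w2 w3 f - weight_hom w1 w2 w3 g"
  using weight_hom_add[of w1 w2 w3 "f - g" g] by simp

lemma weight_hom_sum: "weight_hom w1 w2 w3 (\<Sum>b\<in>B. h b) = (\<Sum>b\<in>B. weight_hom w1 w2 w3 (h b))"
  by (induction B rule: infinite_finite_induct) (simp_all add: weight_hom_simps weight_hom_add)

context weights begin

text \<open>The partial derivatives are homogeneous, so the ideal contains the components of its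
  elements.\<close>

lemma jacobian_ideal_component:
  fixes \<phi> :: "'a::field_char_0 poly3"
  assumes "f \<in> jacobian_ideal \<phi>" and "E \<phi> = of_nat d * \<phi>"
  shows "\<exists>u1 u2 u3. coeff (T f) n = u1 * diff_x \<phi> + u2 * diff_y \<phi> + u3 * diff_z \<phi>"
proof -
  obtain u1 u2 u3 where f: "f = diff_x \<phi> * u1 + diff_y \<phi> * u2 + diff_z \<phi> * u3"
    using jacobian_idealE[OF assms(1)] by (metis mult.commute)
  have multiple: "\<exists>v. component (e + w) k (g * u) = v * g"
    if "monom 1 w * T g = monom g d" for e w k and g u :: "'a poly3"
  proof (cases "k < d")
    case True
    then show ?thesis
      using component_mult(2)[OF that] by (intro exI[of _ 0]) simp
  next
    case False
    then show ?thesis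
      using component_mult(1)[OF that, of e "k - d"] by (metis add.commute le_add_diff_inverse mult.commute not_less)
  qed
  \<comment> \<open>The offset contains each of the three weights, as the products with the partial
    derivatives require.\<close>
  define k where "k = n + (w1 + w2 + w3)"
  have "coeff (T f) n = component (w1 + w2 + w3) k f"
    by (simp add: component_eq k_def)
  also have "\<dots> = component ((w2 + w3) + w1) k (diff_x \<phi> * u1)
      + component ((w1 + w3) + w2) k (diff_y \<phi> * u2) + component ((w1 + w2) + w3) k (diff_z \<phi> * u3)"
    by (simp add: f component_add ac_simps)
  finally show ?thesis
    using multiple weight_hom_partials[OF assms(2)] by metis
qed

text \<open>Finitely many representatives have bounded weight. Reducing a power of \<open>v\<close>
  beyond this bound and taking the component of its weight leaves the power itself in the
  ideal.\<close>

lemma power_in_jacobian_ideal: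
  fixes \<phi> v :: "'a::field_char_0 poly3"
  assumes "isolated_singularity \<phi>" and "E \<phi> = of_nat d * \<phi>" and v: "T v = monom v w" "w > 0"
  shows "\<exists>n u1 u2 u3. v ^ n = u1 * diff_x \<phi> + u2 * diff_y \<phi> + u3 * diff_z \<phi>"
proof -
  obtain B where B: "quotient_basis (jacobian_ideal \<phi>) B"
    using assms(1) by (auto simp: isolated_singularity_def)
  then have "finite B" by (simp add: quotient_basis_def)
  define n where "n = Suc (\<Sum>b\<in>B. degree (T b))"
  obtain c where c: "v ^ n - (\<Sum>b\<in>B. scalar (c b) * b) \<in> jacobian_ideal \<phi>"
    using B unfolding quotient_basis_def by blast
  have "degree (T b) < w * n" if "b \<in> B" for b
  proof -
    have "degree (T b) < n"
      unfolding n_def using member_le_sum[OF that _ \<open>finite B\<close>, of "\<lambda>b. degree (T b)"] by simp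
    also have "n \<le> w * n" using v(2) by simp
    finally show ?thesis .
  qed
  then have "coeff (T (\<Sum>b\<in>B. scalar (c b) * b)) (w * n) = 0"
    by (simp add: weight_hom_sum weight_hom_mult coeff_sum coeff_eq_0)
  then have "coeff (T (v ^ n - (\<Sum>b\<in>B. scalar (c b) * b))) (w * n) = v ^ n"
    by (simp add: weight_hom_diff_eq weight_hom_power[OF v(1)])
  then show ?thesis
    using jacobian_ideal_component[OF c assms(2), of "w * n"] by metis
qed

lemma weighted_potentialI:
  fixes \<phi> :: "'a::field_char_0 poly3"
  assumes iso: "isolated_singularity \<phi>" and euler: "E \<phi> = of_nat d * \<phi>"
  shows "weighted_potential w1 w2 w3 \<phi> d"
proof
  note power = power_in_jacobian_ideal[OF iso euler]
  obtain i u1 u2 u3 where x: "var_x ^ i = u1 * diff_x \<phi> + u2 * diff_y \<phi> + u3 * diff_z \<phi>"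
    using power[of var_x w1] weights_pos by auto
  obtain j v1 v2 v3 where y: "var_y ^ j = v1 * diff_x \<phi> + v2 * diff_y \<phi> + v3 * diff_z \<phi>"
    using power[of var_y w2] weights_pos by auto
  obtain k r1 r2 r3 where z: "var_z ^ k = r1 * diff_x \<phi> + r2 * diff_y \<phi> + r3 * diff_z \<phi>"
    using power[of var_z w3] weights_pos by auto
  have nz: "var_x ^ i \<noteq> (0 :: 'a poly3)" by (simp add: var_x_def)
  \<comment> \<open>In degree 0 all partial derivatives would have to vanish for reasons of weight,
    although they generate a power of x.\<close>
  show "d > 0"
  proof (rule ccontr)
    assume "\<not> d > 0"
    then have d: "d = 0" by simp
    have "g = 0" if "monom 1 w * T g = monom g d" "w > 0" for w and g :: "'a poly3"
      using arg_cong[OF that(1), of "\<lambda>p. coeff p 0"] that(2) by (simp add: d coeff_monom_mult)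
    then have "diff_x \<phi> = 0" "diff_y \<phi> = 0" "diff_z \<phi> = 0"
      using weight_hom_partials[OF euler] weights_pos by blast+
    with x nz show False by simp
  qed
  fix h1 h2 h3
  assume h: "diff_x \<phi> * h1 + diff_y \<phi> * h2 + diff_z \<phi> * h3 = 0"
  show "\<exists>k1 k2 k3. h1 = diff_y \<phi> * k3 - diff_z \<phi> * k2 \<and> h2 = diff_z \<phi> * k1 - diff_x \<phi> * k3
        \<and> h3 = diff_x \<phi> * k2 - diff_y \<phi> * k1"
  proof (rule koszul_exact[OF x y z nz _ _ h])
    show "\<exists>c. a = var_x ^ i * c" if "var_y ^ j * a = var_x ^ i * b" for a b :: "'a poly3"
      using that by (rule var_y_power_regular)
    show "\<exists>b' c'. a = var_x ^ i * b' + var_y ^ j * c'"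
      if "var_z ^ k * a = var_x ^ i * b + var_y ^ j * c" for a b c :: "'a poly3"
      using that by (rule var_z_power_regular)
  qed
qed (fact euler)

end

section \<open>Integrable forms\<close>

text \<open>Abstract, so that the same identities serve polynomials and power series over
  them.\<close>

locale commuting_derivations =
  fixes Dx Dy Dz :: "'r::idom \<Rightarrow> 'r"
  assumes D_add: "Dx (f + g) = Dx f + Dx g" "Dy (f + g) = Dy f + Dy g" "Dz (f + g) = Dz f + Dz g"
    and D_mult: "Dx (f * g) = Dx f * g + f * Dx g" "Dy (f * g) = Dy f * g + f * Dy g"
      "Dz (f * g) = Dz f * g + f * Dz g"
    and D_commute: "Dy (Dx f) = Dx (Dy f)" "Dz (Dx f) = Dx (Dz f)" "Dz (Dy f) = Dy (Dz f)"
begin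

lemma D_diff: "Dx (f - g) = Dx f - Dx g" "Dy (f - g) = Dy f - Dy g" "Dz (f - g) = Dz f - Dz g"
  using D_add[of "f - g" g] by (simp_all add: algebra_simps)

text \<open>The coefficient of \<omega> \<and> df \<and> dg for \<omega> = a dx + b dy + c
  dz.\<close>

definition bracket :: "'r \<Rightarrow> 'r \<Rightarrow> 'r \<Rightarrow> 'r \<Rightarrow> 'r \<Rightarrow> 'r" where
  "bracket a b c f g = a * (Dy f * Dz g - Dz f * Dy g) + b * (Dz f * Dx g - Dx f * Dz g)
    + c * (Dx f * Dy g - Dy f * Dx g)"

text \<open>The coefficient of \<omega> \<and> d\<omega>.\<close>

definition integrability :: "'r \<Rightarrow> 'r \<Rightarrow> 'r \<Rightarrow> 'r" where
  "integrability a b c = a * (Dy c - Dz b) + b * (Dz a - Dx c) + c * (Dx b - Dy a)"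

text \<open>The second factor is the Jacobian determinant of \<open>f\<close>, \<open>g\<close>,
  \<open>h\<close>.\<close>

lemma bracket_jacobiator:
  "bracket a b c (bracket a b c f g) h + bracket a b c (bracket a b c g h) f
    + bracket a b c (bracket a b c h f) g =
   integrability a b c * (Dx f * (Dy g * Dz h - Dz g * Dy h) + Dy f * (Dz g * Dx h - Dx g * Dz h)
    + Dz f * (Dx g * Dy h - Dy g * Dx h))"
  unfolding bracket_def integrability_def D_add D_diff D_mult D_commute by algebra

text \<open>The form u dG is integrable by itself and \<open>s\<close> is a constant for the
  derivations, so every remaining term contains \<open>s\<close>.\<close>

lemma integrability_perturbed:
  assumes "Dx s = 0" "Dy s = 0" "Dz s = 0"
  shows "integrability (u * Dx G + s * a) (u * Dy G + s * b) (u * Dz G + s * c) =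
    s * (u * (Dx G * (Dy c - Dz b) + Dy G * (Dz a - Dx c) + Dz G * (Dx b - Dy a))
      + (a * (Dy u * Dz G - Dz u * Dy G) + b * (Dz u * Dx G - Dx u * Dz G) + c * (Dx u * Dy G - Dy u * Dx G))
      + s * integrability a b c)"
  unfolding integrability_def D_add D_diff D_mult D_commute assms by algebra

end

section \<open>Deformations as forms over power series\<close>

lemma commuting_derivations_diff: "commuting_derivations diff_x diff_y diff_z"
  by unfold_locales (simp_all add: diff_add diff_mult diff_commute)

definition fps_map :: "('a \<Rightarrow> 'b) \<Rightarrow> 'a fps \<Rightarrow> 'b fps" where
  "fps_map d F = Abs_fps (\<lambda>n. d (fps_nth F n))"

lemma fps_map_nth [simp]: "fps_nth (fps_map d F) n = d (fps_nth F n)"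
  by (simp add: fps_map_def)

lemma derivation_fps_map:
  fixes d :: "'b::comm_ring_1 \<Rightarrow> 'b"
  assumes add: "\<And>a b. d (a + b) = d a + d b" and mult: "\<And>a b. d (a * b) = d a * b + a * d b"
  shows "fps_map d (F + G) = fps_map d F + fps_map d G"
    and "fps_map d (F * G) = fps_map d F * G + F * fps_map d G"
proof -
  have d0: "d 0 = 0"
    using add[of 0 0] by simp
  have dsum: "d (\<Sum>i\<in>A. h i) = (\<Sum>i\<in>A. d (h i))" for A :: "nat set" and h
    by (induction A rule: infinite_finite_induct) (simp_all add: d0 add)
  show "fps_map d (F + G) = fps_map d F + fps_map d G"
    by (rule fps_ext) (simp add: add)
  show "fps_map d (F * G) = fps_map d F * G + F * fps_map d G"
    by (rule fps_ext) (simp add: fps_mult_nth dsum mult sum.distrib)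
qed

interpretation poly3: commuting_derivations diff_x diff_y diff_z
  by (rule commuting_derivations_diff)

interpretation series: commuting_derivations "fps_map diff_x" "fps_map diff_y" "fps_map diff_z"
proof
  fix f g :: "'a poly3 fps"
  show "fps_map diff_y (fps_map diff_x f) = fps_map diff_x (fps_map diff_y f)"
    "fps_map diff_z (fps_map diff_x f) = fps_map diff_x (fps_map diff_z f)"
    "fps_map diff_z (fps_map diff_y f) = fps_map diff_y (fps_map diff_z f)"
    by (simp_all add: fps_eq_iff diff_commute)
qed (intro derivation_fps_map diff_add diff_mult)+

lemma fps_map_diff_X_power [simp]:
  "fps_map diff_x (fps_X ^ n) = 0" "fps_map diff_y (fps_X ^ n) = 0" "fps_map diff_z (fps_X ^ n) = 0"
  using diff_of_nat[of 1] by (simp_all add: fps_eq_iff)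

lemma fps_map_diff_const [simp]:
  "fps_map diff_x (fps_const c) = fps_const (diff_x c)"
  "fps_map diff_y (fps_const c) = fps_const (diff_y c)"
  "fps_map diff_z (fps_const c) = fps_const (diff_z c)"
  by (simp_all add: fps_eq_iff)

lemma skew_biderivation_eq_bracket:
  assumes P: "skew_biderivation P"
  shows "P = poly3.bracket (P var_y var_z) (P var_z var_x) (P var_x var_y)"
proof (intro ext)
  fix f g
  let ?B = "poly3.bracket (P var_y var_z) (P var_z var_x) (P var_x var_y)"
  have skew: "P f g = - P g f" and der: "derivation (\<lambda>f. P f g)" "derivation (P f)" for f g
    using P unfolding skew_biderivation_def by blast+
  have zero: "P f f = 0" for f
    using skew[of f f] by (simp add: equal_neg_zero)
  have derB: "derivation (\<lambda>f. ?B f g)" "derivation (?B f)" for f g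
    by (simp_all add: derivation_def poly3.bracket_def diff_add diff_mult algebra_simps)
  have P_gen: "P var_y var_x = - P var_x var_y" "P var_z var_y = - P var_y var_z"
    "P var_x var_z = - P var_z var_x"
    by (rule skew)+
  have gen: "P u v = ?B u v" if "u \<in> {var_x, var_y, var_z}" "v \<in> {var_x, var_y, var_z}" for u v
    using that by (elim insertE emptyE; hypsubst)
      (simp_all add: poly3.bracket_def zero P_gen)
  have *: "P u g = ?B u g" if "u \<in> {var_x, var_y, var_z}" for u
    by (rule derivation_eqI[OF der(2) derB(2)]) (rule gen[OF that]; simp)+
  show "P f g = ?B f g"
    by (rule derivation_eqI[OF der(1) derB(1)]) (rule *; simp)+
qed

lemma skew_biderivation_bracket: "skew_biderivation (poly3.bracket a b c)"
  by (simp add: skew_biderivation_def derivation_def poly3.bracket_def diff_add diff_mult algebra_simps)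

lemma fps_bilinear_ext_bracket:
  "fps_bilinear_ext (poly3.bracket a b c) = series.bracket (fps_const a) (fps_const b) (fps_const c)"
  by (intro ext fps_ext)
    (simp add: fps_bilinear_ext_def poly3.bracket_def series.bracket_def, simp add: fps_mult_nth atLeast0AtMost
      sum.distrib sum_subtractf sum_distrib_left right_diff_distrib)

text \<open>On pairs of coordinates, these series are the coefficients of the form \<omega> that
  belongs to the deformation.\<close>

definition truncated_coeff :: "nat \<Rightarrow> (nat \<Rightarrow> 'a::field_char_0 poly3 \<Rightarrow> 'a poly3 \<Rightarrow> 'a poly3) \<Rightarrow>
    'a poly3 \<Rightarrow> 'a poly3 \<Rightarrow> 'a poly3 fps" where
  "truncated_coeff m \<pi> f g = (\<Sum>i\<le>m. fps_X ^ i * fps_const (\<pi> i f g))"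

lemma truncated_bracket_eq:
  assumes "\<And>i. i \<le> m \<Longrightarrow> skew_biderivation (\<pi> i)"
  shows "truncated_bracket m \<pi> = series.bracket (truncated_coeff m \<pi> var_y var_z)
    (truncated_coeff m \<pi> var_z var_x) (truncated_coeff m \<pi> var_x var_y)"
proof (intro ext)
  fix f g
  have ext: "fps_bilinear_ext (\<pi> i) = series.bracket (fps_const (\<pi> i var_y var_z))
      (fps_const (\<pi> i var_z var_x)) (fps_const (\<pi> i var_x var_y))" if "i \<le> m" for i
    by (subst skew_biderivation_eq_bracket[OF assms[OF that]]) (rule fps_bilinear_ext_bracket)
  have "truncated_bracket m \<pi> f g = (\<Sum>i\<le>m. fps_X ^ i * series.bracket (fps_const (\<pi> i var_y var_z))
      (fps_const (\<pi> i var_z var_x)) (fps_const (\<pi> i var_x var_y)) f g)"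
    unfolding truncated_bracket_def by (intro sum.cong refl) (simp add: ext)
  also have "\<dots> = series.bracket (truncated_coeff m \<pi> var_y var_z)
    (truncated_coeff m \<pi> var_z var_x) (truncated_coeff m \<pi> var_x var_y) f g"
    by (simp add: series.bracket_def truncated_coeff_def sum_distrib_right sum.distrib distrib_left mult.assoc)
  finally show "truncated_bracket m \<pi> f g = \<dots>" .
qed

text \<open>The Jacobiator is the integrability term times a Jacobian determinant, which is 1 on the
  coordinates.\<close>

lemma deformation_iff:
  assumes skew: "\<And>i. i \<le> m \<Longrightarrow> skew_biderivation (\<pi> i)"
  shows "deformation m P \<pi> \<longleftrightarrow> poisson_bracket P \<and> \<pi> 0 = P \<and>
    fps_X ^ (m + 1) dvd series.integrability (truncated_coeff m \<pi> var_y var_z)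
      (truncated_coeff m \<pi> var_z var_x) (truncated_coeff m \<pi> var_x var_y)"
    (is "_ \<longleftrightarrow> _ \<and> _ \<and> ?X dvd ?I")
proof -
  have "(\<forall>f g h. ?X dvd ?I * (fps_map diff_x f * (fps_map diff_y g * fps_map diff_z h - fps_map diff_z g * fps_map diff_y h)
    + fps_map diff_y f * (fps_map diff_z g * fps_map diff_x h - fps_map diff_x g * fps_map diff_z h)
    + fps_map diff_z f * (fps_map diff_x g * fps_map diff_y h - fps_map diff_y g * fps_map diff_x h)))
    \<longleftrightarrow> ?X dvd ?I" (is "?L \<longleftrightarrow> _")
  proof
    assume ?L
    from this[rule_format, of "fps_const var_x" "fps_const var_y" "fps_const var_z"] show "?X dvd ?I"
      by simp
  qed simp
  moreover have "truncated_bracket m \<pi> = series.bracket (truncated_coeff m \<pi> var_y var_z)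
      (truncated_coeff m \<pi> var_z var_x) (truncated_coeff m \<pi> var_x var_y)"
    by (rule truncated_bracket_eq) (rule skew)
  ultimately show ?thesis
    unfolding deformation_def using skew by (simp only: series.bracket_jacobiator) blast
qed

section \<open>Integrating factors and the extension step\<close>

context weighted_potential begin

lemma integrable_factorization:
  fixes P1 P2 P3 :: "'a poly3 fps"
  assumes P0: "fps_nth P1 0 = diff_x \<phi>" "fps_nth P2 0 = diff_y \<phi>" "fps_nth P3 0 = diff_z \<phi>"
    and integrable: "fps_X ^ (m + 1) dvd series.integrability P1 P2 P3"
    and "k \<le> m"
  shows "\<exists>u G a b c. fps_nth u 0 = 1 \<and> fps_nth G 0 = \<phi> \<and>
    P1 = u * fps_map diff_x G + fps_X ^ (k + 1) * a \<and>
    P2 = u * fps_map diff_y G + fps_X ^ (k + 1) * b \<and>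
    P3 = u * fps_map diff_z G + fps_X ^ (k + 1) * c"
  using \<open>k \<le> m\<close>
proof (induction k)
  case 0
  have X_mult: "F = fps_const (fps_nth F 0) + fps_X * fps_shift 1 F" for F :: "'a poly3 fps"
    by (rule fps_ext) simp
  show ?case
    using X_mult[of P1] X_mult[of P2] X_mult[of P3]
    by (intro exI[of _ 1] exI[of _ "fps_const \<phi>"] exI[of _ "fps_shift 1 P1"]
        exI[of _ "fps_shift 1 P2"] exI[of _ "fps_shift 1 P3"]) (simp add: P0)
next
  case (Suc k)
  let ?X = "fps_X ^ (k + 1) :: 'a poly3 fps"
  obtain u G a b c where u: "fps_nth u 0 = 1" and G: "fps_nth G 0 = \<phi>"
    and P: "P1 = u * fps_map diff_x G + ?X * a" "P2 = u * fps_map diff_y G + ?X * b"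
      "P3 = u * fps_map diff_z G + ?X * c"
    using Suc by auto
  define R where "R = u * (fps_map diff_x G * (fps_map diff_y c - fps_map diff_z b)
      + fps_map diff_y G * (fps_map diff_z a - fps_map diff_x c) + fps_map diff_z G * (fps_map diff_x b - fps_map diff_y a))
    + (a * (fps_map diff_y u * fps_map diff_z G - fps_map diff_z u * fps_map diff_y G)
      + b * (fps_map diff_z u * fps_map diff_x G - fps_map diff_x u * fps_map diff_z G)
      + c * (fps_map diff_x u * fps_map diff_y G - fps_map diff_y u * fps_map diff_x G))
    + ?X * series.integrability a b c"
  have "series.integrability P1 P2 P3 = ?X * R"
    unfolding P R_def by (intro series.integrability_perturbed fps_map_diff_X_power)
  \<comment> \<open>\<open>Suc k \<le> m\<close> provides one more factor \<nu> than was split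
    off.\<close>
  moreover have "?X * fps_X dvd series.integrability P1 P2 P3"
  proof (rule dvd_trans[OF _ integrable])
    show "?X * fps_X dvd fps_X ^ (m + 1)"
      using Suc.prems by (subst power_Suc2[symmetric], intro le_imp_power_dvd) simp
  qed
  ultimately have "fps_X dvd R" by simp
  then have R0: "fps_nth R 0 = 0" by auto
  have diff_1: "diff_x 1 = (0 :: 'a poly3)" "diff_y 1 = (0 :: 'a poly3)" "diff_z 1 = (0 :: 'a poly3)"
    using diff_of_nat[of 1] by simp_all
  \<comment> \<open>At order 0 the derivatives of \<open>u\<close> vanish because \<open>u\<close>
    starts with 1, and what is left of \<open>R\<close> is d\<phi> \<and> d\<eta> for the leading
    remainder \<eta>.\<close>
  have "diff_x \<phi> * (diff_y (fps_nth c 0) - diff_z (fps_nth b 0)) + diff_y \<phi> * (diff_z (fps_nth a 0) - diff_x (fps_nth c 0))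
    + diff_z \<phi> * (diff_x (fps_nth b 0) - diff_y (fps_nth a 0)) = 0"
    using R0 by (simp add: R_def u G diff_1)
  from relative_closed[OF this] obtain f g where
    fg: "fps_nth a 0 = f * diff_x \<phi> + diff_x g" "fps_nth b 0 = f * diff_y \<phi> + diff_y g"
      "fps_nth c 0 = f * diff_z \<phi> + diff_z g" by blast
  \<comment> \<open>The correction of \<open>u\<close> absorbs f d\<phi>, that of \<open>G\<close>
    absorbs dg.\<close>
  define u' G' where "u' = u + ?X * fps_const f" and "G' = G + ?X * fps_const g"
  have step: "\<exists>e'. u * D G + ?X * e = u' * (D G + ?X * fps_const (d g)) + fps_X ^ (Suc k + 1) * e'"
    if "fps_nth e 0 = f * d \<phi> + d g" "D = fps_map d" for D d and e :: "'a poly3 fps"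
  proof -
    define r where "r = e - fps_const f * D G - u * fps_const (d g) - ?X * (fps_const f * fps_const (d g))"
    have "fps_nth r 0 = 0"
      using that by (simp add: r_def u G)
    then have "r = fps_X * fps_shift 1 r"
      by (intro fps_ext) simp
    then obtain e' where "r = fps_X * e'" by blast
    then have "?X * r = fps_X ^ (Suc k + 1) * e'"
      by (simp add: ac_simps)
    moreover have "u * D G + ?X * e = u' * (D G + ?X * fps_const (d g)) + ?X * r"
      unfolding u'_def r_def by (simp only: ring_distribs ac_simps) simp
    ultimately show ?thesis by metis
  qed
  have DG': "fps_map diff_x G' = fps_map diff_x G + ?X * fps_const (diff_x g)"
    "fps_map diff_y G' = fps_map diff_y G + ?X * fps_const (diff_y g)"
    "fps_map diff_z G' = fps_map diff_z G + ?X * fps_const (diff_z g)"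
    unfolding G'_def series.D_add series.D_mult fps_map_diff_X_power by simp_all
  have "fps_nth u' 0 = 1" "fps_nth G' 0 = \<phi>"
    by (simp_all add: u'_def G'_def u G)
  then show ?case
    using step[OF fg(1) refl] step[OF fg(2) refl] step[OF fg(3) refl] unfolding P DG'[symmetric]
    by blast
qed

text \<open>The new coefficient replaces the one of \<nu>^(m+1) by that of u dG, so the deviation
  from an integrable form starts one order later.\<close>

lemma integrable_extension:
  fixes P1 P2 P3 :: "'a poly3 fps"
  assumes "fps_nth P1 0 = diff_x \<phi>" "fps_nth P2 0 = diff_y \<phi>" "fps_nth P3 0 = diff_z \<phi>"
    and "fps_X ^ (m + 1) dvd series.integrability P1 P2 P3"
  shows "\<exists>a b c. fps_X ^ (m + 2) dvd series.integrability (P1 + fps_X ^ (m + 1) * fps_const a)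
    (P2 + fps_X ^ (m + 1) * fps_const b) (P3 + fps_X ^ (m + 1) * fps_const c)"
proof -
  let ?X = "fps_X ^ (m + 1) :: 'a poly3 fps"
  obtain u G a b c where P: "P1 = u * fps_map diff_x G + ?X * a"
    "P2 = u * fps_map diff_y G + ?X * b" "P3 = u * fps_map diff_z G + ?X * c"
    using integrable_factorization[OF assms order_refl] by blast
  \<comment> \<open>Subtracting the leading coefficient of the remainder leaves a multiple of
    \<nu>^(m+2), which then takes the role of \<open>s\<close> in
    \<open>integrability_perturbed\<close>.\<close>
  have *: "v + ?X * e + ?X * fps_const (- fps_nth e 0) = v + fps_X ^ (m + 2) * fps_shift 1 e"
    for v and e :: "'a poly3 fps"
  proof -
    have "e + fps_const (- fps_nth e 0) = fps_X * fps_shift 1 e"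
      by (rule fps_ext) simp
    then have "?X * (e + fps_const (- fps_nth e 0)) = fps_X ^ (m + 2) * fps_shift 1 e"
      by (simp only: mult.assoc[symmetric]) (simp add: mult.commute)
    then show ?thesis by (simp only: distrib_left add.assoc)
  qed
  show ?thesis
    unfolding P
    by (intro exI[of _ "- fps_nth a 0"] exI[of _ "- fps_nth b 0"] exI[of _ "- fps_nth c 0"])
      (simp only: * series.integrability_perturbed[OF fps_map_diff_X_power] dvd_triv_left)
qed

end

theorem corollary3p5:
  fixes \<phi> :: "'a::field_char_0 poly3"
    and m :: nat
    and \<pi> :: "nat \<Rightarrow> 'a poly3 \<Rightarrow> 'a poly3 \<Rightarrow> 'a poly3"
  assumes "weight_homogeneous \<phi>"
    and "isolated_singularity \<phi>"
    and "m \<ge> 1"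
    and "deformation m (jacobian_bracket \<phi>) \<pi>"
  shows "\<exists>P. skew_biderivation P \<and>
           deformation (m + 1) (jacobian_bracket \<phi>) (\<pi>(m + 1 := P))"
proof -
  obtain w1 w2 w3 d where "w1 > 0" "w2 > 0" "w3 > 0" "euler w1 w2 w3 \<phi> = of_nat d * \<phi>"
    using assms(1) unfolding weight_homogeneous_def euler_def by metis
  then interpret weighted_potential w1 w2 w3 \<phi> d
    using assms(2) by (intro weights.weighted_potentialI weights.intro)
  have \<pi>: "\<And>i. i \<le> m \<Longrightarrow> skew_biderivation (\<pi> i)" "\<pi> 0 = jacobian_bracket \<phi>"
    using assms(4) by (simp_all add: deformation_def)
  have nth_0: "fps_nth (truncated_coeff m \<pi> f g) 0 = jacobian_bracket \<phi> f g" for f g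
    by (simp add: truncated_coeff_def fps_sum_nth fps_X_power_mult_nth sum.atMost_shift \<pi>(2))
  have "fps_X ^ (m + 1) dvd series.integrability (truncated_coeff m \<pi> var_y var_z)
      (truncated_coeff m \<pi> var_z var_x) (truncated_coeff m \<pi> var_x var_y)"
    using deformation_iff[of m \<pi>] \<pi>(1) assms(4) by blast
  then obtain a b c where ext: "fps_X ^ (m + 2) dvd series.integrability
      (truncated_coeff m \<pi> var_y var_z + fps_X ^ (m + 1) * fps_const a)
      (truncated_coeff m \<pi> var_z var_x + fps_X ^ (m + 1) * fps_const b)
      (truncated_coeff m \<pi> var_x var_y + fps_X ^ (m + 1) * fps_const c)"
    using integrable_extension[of "truncated_coeff m \<pi> var_y var_z" "truncated_coeff m \<pi> var_z var_x"
        "truncated_coeff m \<pi> var_x var_y" m]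
    by (auto simp: nth_0 jacobian_bracket_generators)
  define P where "P = poly3.bracket a b c"
  have P_gen: "P var_y var_z = a" "P var_z var_x = b" "P var_x var_y = c"
    by (simp_all add: P_def poly3.bracket_def)
  have coeff: "truncated_coeff (m + 1) (\<pi>(m + 1 := P)) f g
      = truncated_coeff m \<pi> f g + fps_X ^ (m + 1) * fps_const (P f g)" for f g
    by (simp add: truncated_coeff_def)
  have skew: "skew_biderivation P"
    unfolding P_def by (rule skew_biderivation_bracket)
  then have "skew_biderivation ((\<pi>(m + 1 := P)) i)" if "i \<le> m + 1" for i
    using \<pi>(1) that by auto
  then have "deformation (m + 1) (jacobian_bracket \<phi>) (\<pi>(m + 1 := P))"
    using ext by (subst deformation_iff) (simp_all only: coeff P_gen,
      simp_all add: \<pi>(2) jacobian_bracket_poisson)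
  with skew show ?thesis by blast
qed

end
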